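(* Let $(U_t)_{t\geq 0}$ be a Brownian motion with $\sigma=1$ reflected at $0$ and $1$, with $U_0$ uniform on $(0,1)$, and let $C_t$ be the copula of $(U_s,U_{s+t})$ for $t\geq 0$ (which does not depend on $s\ge 0$). Then there do not exist a constant $a>0$ and copulas $E$ and $C$ with $C\ast E=E\ast C=C$ and $E\ast E=E$ such that $$C_t=e^{-at}\Bigl(E+\sum_{n=1}^{\infty}\frac{a^nt^n}{n!}C^{\ast n}\Bigr)\qquad\text{for all } t\geq 0.$$ In particular, not every family of copulas of a time-homogeneous Markov process can be expressed in this form.
   Context: A (two-dimensional) copula is the joint distribution function of a random vector whose two marginals are uniform on $[0,1]$. The Markov product $C\ast D$ of two copulas is defined as follows: if $X_0,X_1,X_2$ is a Markov chain with uniform marginals on $[0,1]$ such that $(X_0,X_1)$ has joint distribution function $C$ and $(X_1,X_2)$ has joint distribution function $D$, then $C\ast D$ is the joint distribution function of $(X_0,X_2)$. Equivalently, $(C\ast D)(x,y)=\int_0^1 \partial_2C(x,u)\,\partial_1D(u,y)\,du$. $C^{\ast n}$ denotes the $n$-fold Markov product of $C$ with itself. The reflected Brownian motion $(U_t)$ is a stationary time-homogeneous Markov process with uniform marginals, so $C_t$ is the joint distribution function of $(U_s,U_{s+t})$. Explicitly, $C_0(x,y)=\min(x,y)$, and for $t>0$ the copula $C_t$ has density on $(0,1)^2$ $$c_t(x,y)=\frac{1}{\sqrt{2\pi t}}\sum_{n\in\mathbb{Z}}\Bigl(e^{-(2n+y-x)^2/(2t)}+e^{-(2n-y-x)^2/(2t)}\Bigr).$$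 *)

theory Defs
  imports "HOL-Probability.Probability"
begin

definition uniform_rv :: "'a measure \<Rightarrow> ('a \<Rightarrow> real) \<Rightarrow> bool" where
  "uniform_rv M X \<longleftrightarrow>
     X \<in> borel_measurable M \<and> distr M borel X = uniform_measure lborel {0..1}"

definition joint_cdf ::
  "'a measure \<Rightarrow> ('a \<Rightarrow> real) \<Rightarrow> ('a \<Rightarrow> real) \<Rightarrow> real \<Rightarrow> real \<Rightarrow> real" where
  "joint_cdf M X Y x y = measure M {\<omega> \<in> space M. X \<omega> \<le> x \<and> Y \<omega> \<le> y}"

text \<open>Copulas are distribution functions on the whole plane, so that equality of copulas is
  equality of functions; outside the unit square the values are determined by those inside.
  Every law on the plane is realised on the canonical space, hence the type of \<open>M\<close> is
  no restriction.\<close>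

definition copula :: "(real \<Rightarrow> real \<Rightarrow> real) \<Rightarrow> bool" where
  "copula C \<longleftrightarrow> (\<exists>(M :: (real \<times> real) measure) X Y.
     prob_space M \<and> uniform_rv M X \<and> uniform_rv M Y \<and> C = joint_cdf M X Y)"

definition past ::
  "'a measure \<Rightarrow> 'i::linorder set \<Rightarrow> ('i \<Rightarrow> 'a \<Rightarrow> real) \<Rightarrow> 'i \<Rightarrow> 'a measure" where
  "past M T X s =
     sigma (space M) {X u -` A \<inter> space M |u A. u \<in> T \<and> u \<le> s \<and> A \<in> sets borel}"

definition markov_process ::
  "'a measure \<Rightarrow> 'i::linorder set \<Rightarrow> ('i \<Rightarrow> 'a \<Rightarrow> real) \<Rightarrow> bool" where
  "markov_process M T X \<longleftrightarrow>
     prob_space M \<and> (\<forall>t\<in>T. X t \<in> borel_measurable M) \<and>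
     (\<forall>s\<in>T. \<forall>t\<in>T. s \<le> t \<longrightarrow> (\<forall>A\<in>sets borel. AE \<omega> in M.
        real_cond_exp M (past M T X s) (\<lambda>\<omega>. indicator A (X t \<omega>)) \<omega> =
        real_cond_exp M (vimage_algebra (space M) (X s) borel) (\<lambda>\<omega>. indicator A (X t \<omega>)) \<omega>))"

text \<open>\<open>K t x\<close> is the law of the state at time \<open>s + t\<close> given state \<open>x\<close> at time \<open>s\<close>.\<close>

definition time_homogeneous_markov_process :: "'a measure \<Rightarrow> (real \<Rightarrow> 'a \<Rightarrow> real) \<Rightarrow> bool" where
  "time_homogeneous_markov_process M X \<longleftrightarrow>
     markov_process M {0..} X \<and>
     (\<exists>K. (\<forall>t\<ge>0. K t \<in> borel \<rightarrow>\<^sub>M prob_algebra borel) \<and>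
        (\<forall>s\<ge>0. \<forall>t\<ge>0. \<forall>A\<in>sets borel. AE \<omega> in M.
           real_cond_exp M (vimage_algebra (space M) (X s) borel)
             (\<lambda>\<omega>. indicator A (X (s + t) \<omega>)) \<omega> = measure (K t (X s \<omega>)) A))"

text \<open>For copulas \<open>C\<close> and \<open>D\<close> such a chain exists (disintegrate both laws along \<open>X 1\<close>) and its
  law is unique, since \<open>X 0\<close> and \<open>X 2\<close> are conditionally independent given \<open>X 1\<close>; thus the
  description is proper.\<close>

definition markov_product ::
  "(real \<Rightarrow> real \<Rightarrow> real) \<Rightarrow> (real \<Rightarrow> real \<Rightarrow> real) \<Rightarrow> real \<Rightarrow> real \<Rightarrow> real" (infixl "\<star>" 70) where
  "C \<star> D = (THE F. \<exists>(M :: (real \<times> real \<times> real) measure) X.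
     markov_process M {0, 1, 2 :: nat} X \<and> (\<forall>i\<in>{0, 1, 2}. uniform_rv M (X i)) \<and>
     joint_cdf M (X 0) (X 1) = C \<and> joint_cdf M (X 1) (X 2) = D \<and>
     joint_cdf M (X 0) (X 2) = F)"

text \<open>The \<open>n\<close>-fold product, meant for \<open>n \<ge> 1\<close>.\<close>

definition markov_power :: "(real \<Rightarrow> real \<Rightarrow> real) \<Rightarrow> nat \<Rightarrow> real \<Rightarrow> real \<Rightarrow> real" where
  "markov_power C n = ((\<lambda>F. F \<star> C) ^^ (n - 1)) C"

text \<open>The series over \<open>n \<ge> 1\<close> is indexed by \<open>Suc n\<close>. Its convergence is part of the identity;
  it is automatic because copulas take values in the unit interval.\<close>

definition exponential_form :: "(real \<Rightarrow> real \<Rightarrow> real \<Rightarrow> real) \<Rightarrow> bool" where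
  "exponential_form Ct \<longleftrightarrow> (\<exists>a E C. a > 0 \<and> copula E \<and> copula C \<and>
     C \<star> E = C \<and> E \<star> C = C \<and> E \<star> E = E \<and>
     (\<forall>t\<ge>0. \<forall>x y.
        summable (\<lambda>n. a ^ Suc n * t ^ Suc n / fact (Suc n) * markov_power C (Suc n) x y) \<and>
        Ct t x y = exp (- (a * t)) *
          (E x y + (\<Sum>n. a ^ Suc n * t ^ Suc n / fact (Suc n) * markov_power C (Suc n) x y))))"

text \<open>For uniform marginals the copula of a pair is its joint distribution function.\<close>

definition copula_family ::
  "'a measure \<Rightarrow> (real \<Rightarrow> 'a \<Rightarrow> real) \<Rightarrow> (real \<Rightarrow> real \<Rightarrow> real \<Rightarrow> real) \<Rightarrow> bool" where
  "copula_family M U Ct \<longleftrightarrow>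
     (\<forall>s\<ge>0. uniform_rv M (U s)) \<and>
     (\<forall>s\<ge>0. \<forall>t\<ge>0. joint_cdf M (U s) (U (s + t)) = Ct t)"

text \<open>The initial value \<open>W 0\<close> is arbitrary and, being part of the past, independent of all
  increments.\<close>

definition brownian_motion :: "real \<Rightarrow> 'a measure \<Rightarrow> (real \<Rightarrow> 'a \<Rightarrow> real) \<Rightarrow> bool" where
  "brownian_motion \<sigma> M W \<longleftrightarrow>
     prob_space M \<and> (\<forall>t\<ge>0. W t \<in> borel_measurable M) \<and>
     (AE \<omega> in M. continuous_on {0..} (\<lambda>t. W t \<omega>)) \<and>
     (\<forall>s\<ge>0. \<forall>t>s.
        distributed M lborel (\<lambda>\<omega>. W t \<omega> - W s \<omega>) (normal_density 0 (\<sigma> * sqrt (t - s))) \<and>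
        prob_space.indep_set M (sets (past M {0..} W s))
          (sets (vimage_algebra (space M) (\<lambda>\<omega>. W t \<omega> - W s \<omega>) borel)))"

text \<open>The distance to the nearest even integer: the even 2-periodic extension of the identity
  on the unit interval, which folds the line by reflection at 0 and 1.\<close>

definition fold01 :: "real \<Rightarrow> real" where
  "fold01 x = \<bar>x - 2 * of_int (round (x / 2))\<bar>"

definition process_law :: "'a measure \<Rightarrow> (real \<Rightarrow> 'a \<Rightarrow> real) \<Rightarrow> (real \<Rightarrow> real) measure" where
  "process_law M X = distr M (\<Pi>\<^sub>M t\<in>{0..}. borel) (\<lambda>\<omega>. \<lambda>t\<in>{0..}. X t \<omega>)"

text \<open>A Brownian motion reflected at 0 and 1 is a continuous process having the law of a
  Brownian motion, started in the unit interval, folded at 0 and 1. Only the law is prescribed,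
  so the process need not live on a space that carries the unreflected Brownian motion. Its
  transition density is the sum over the images \<open>2 * n + y\<close> and \<open>2 * n - y\<close> of \<open>y\<close>.\<close>

definition reflected_brownian_motion ::
  "real \<Rightarrow> 'a measure \<Rightarrow> (real \<Rightarrow> 'a \<Rightarrow> real) \<Rightarrow> bool" where
  "reflected_brownian_motion \<sigma> M U \<longleftrightarrow>
     prob_space M \<and> (\<forall>t\<ge>0. U t \<in> borel_measurable M) \<and>
     (AE \<omega> in M. continuous_on {0..} (\<lambda>t. U t \<omega>)) \<and>
     (\<exists>(N :: (real \<Rightarrow> real) measure) W.
        brownian_motion \<sigma> N W \<and> (AE \<omega> in N. W 0 \<omega> \<in> {0..1}) \<and>
        process_law M U = process_law N (\<lambda>t \<omega>. fold01 (W t \<omega>)))"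

end

theory Submission
  imports Defs
begin

text \<open>An exponential form is \<open>exp (- a t)\<close> times a power series in \<open>t\<close> that converges for all
  \<open>t \<ge> 0\<close>, so \<open>t \<mapsto> C\<^sub>t(x, y)\<close> is the restriction of a differentiable function on the line,
  whatever the coefficients (the Markov powers of \<open>C\<close>) are.

  For reflected Brownian motion the probability of \<open>U 0 \<le> 1/2 < U t\<close> is at least a constant
  times \<open>sqrt t\<close> for small \<open>t\<close>, so \<open>C\<^sub>t(1/2, 1/2)\<close> is not differentiable at \<open>t = 0\<close>. The symmetry of Gaussian
  increments makes the folded process Markov with a kernel that preserves the uniform law,
  because \<open>u + g\<close> and \<open>g - u\<close> with \<open>u\<close> uniform together sweep out one full period of the folding
  map; hence the copulas do not depend on the starting time.

  For the second claim the rotation of the circle already suffices: its copulas satisfy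
  \<open>C\<^sub>t(1/2, 1/2) = \<bar>1/2 - t\<bar>\<close> on \<open>[0, 1]\<close>, which has a kink at \<open>t = 1/2\<close>.\<close>

section \<open>Integrals over the uniform law and over full periods\<close>

abbreviation unif01 :: "real measure" where
  "unif01 \<equiv> uniform_measure lborel {0..1}"

lemma prob_space_unif01: "prob_space unif01"
  by (rule prob_space_uniform_measure) auto

text \<open>The endpoints 0 and 1 are null, so \<open>S\<close> may be the unit interval with either
  endpoint kept or dropped. The half-open choices let translated and reflected copies abut without
  overlap in the period arguments.\<close>

lemma nn_integral_unif01:
  assumes [measurable]: "f \<in> borel_measurable borel" "S \<in> sets borel"
    and S: "{0<..<1} \<subseteq> S" "S \<subseteq> {0..1}"
  shows "(\<integral>\<^sup>+u. f u \<partial>unif01) = (\<integral>\<^sup>+u. f u * indicator S u \<partial>lborel)"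
proof -
  have "(\<integral>\<^sup>+u. f u \<partial>unif01) = (\<integral>\<^sup>+u. f u * indicator {0..1} u \<partial>lborel)"
    by (subst nn_integral_uniform_measure) (auto simp: divide_ennreal_def)
  also have "\<dots> = (\<integral>\<^sup>+u. f u * indicator S u \<partial>lborel)"
  proof (rule nn_integral_cong_AE)
    show "AE u in lborel. f u * indicator {0..1} u = f u * indicator S u"
      using AE_lborel_singleton[of "0::real"] AE_lborel_singleton[of "1::real"]
    proof eventually_elim
      case (elim u)
      then have "u \<in> {0..1} \<longleftrightarrow> u \<in> {0<..<1}" by auto
      then have "u \<in> {0..1} \<longleftrightarrow> u \<in> S" using S by blast
      then show ?case by (simp add: indicator_def)
    qed
  qed
  finally show ?thesis .
qed

lemma emeasure_unif01:
  assumes "B \<in> sets borel"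
  shows "emeasure unif01 B = (\<integral>\<^sup>+u. indicator B u \<partial>unif01)"
  using assms by simp

lemma measure_unif01_half: "measure unif01 {..1 / 2} = 1 / 2"
proof -
  have "{0..1} \<inter> {..1 / 2} = {0..1 / 2 :: real}" by auto
  then show ?thesis by (simp add: measure_uniform_measure)
qed

lemma uniform_rv_measure_le_half:
  assumes "uniform_rv M X"
  shows "measure M {\<omega> \<in> space M. X \<omega> \<le> 1 / 2} = 1 / 2"
proof -
  have X: "X \<in> borel_measurable M" "distr M borel X = unif01"
    using assms by (auto simp: uniform_rv_def)
  have "{\<omega> \<in> space M. X \<omega> \<le> 1 / 2} = X -` {..1 / 2} \<inter> space M" by auto
  then show ?thesis
    using measure_distr[OF X(1), of "{..1 / 2}"] by (simp add: X(2) measure_unif01_half)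
qed

text \<open>Subtracting the whole number \<open>k\<close> of periods moves the window to
  \<open>{r..<r + p}\<close> with \<open>0 \<le> r < p\<close>. Its overhang
  \<open>{p..<r + p}\<close> is then moved back by one period onto \<open>{0..<r}\<close>, which is
  exactly the missing piece.\<close>

lemma nn_integral_period_shift:
  fixes h :: "real \<Rightarrow> ennreal"
  assumes [measurable]: "h \<in> borel_measurable borel" and p: "p > 0"
    and per: "\<And>x. h (x + p) = h x"
  shows "(\<integral>\<^sup>+x. h x * indicator {c..<c + p} x \<partial>lborel) = (\<integral>\<^sup>+x. h x * indicator {0..<p} x \<partial>lborel)"
proof -
  define k where "k = \<lfloor>c / p\<rfloor>"
  define r where "r = c - of_int k * p"
  have r: "0 \<le> r" "r < p"
  proof -
    have "of_int k \<le> c / p" "c / p < of_int k + 1" unfolding k_def by linarith+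
    then show "0 \<le> r" "r < p" using p by (auto simp: r_def field_simps)
  qed
  have pern: "h (x + real n * p) = h x" for x n
  proof (induction n)
    case (Suc n)
    have "h (x + real (Suc n) * p) = h ((x + real n * p) + p)" by (simp add: algebra_simps)
    then show ?case using per Suc by simp
  qed simp
  have perk: "h (of_int j * p + x) = h x" for x and j :: int
  proof (cases "j \<ge> 0")
    case True
    then show ?thesis using pern[of x "nat j"] by (simp add: algebra_simps)
  next
    \<comment> \<open>For negative \<open>j\<close> the argument \<open>of_int j * p + x\<close> is
      the base point, and adding \<open>- j\<close> periods to it returns to
      \<open>x\<close>.\<close>
    case False
    then show ?thesis using pern[of "x + of_int j * p" "nat (- j)"] by (simp add: algebra_simps)
  qed
  have shift: "(\<integral>\<^sup>+x. h x * indicator {of_int j * p + a..<of_int j * p + b} x \<partial>lborel) =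
      (\<integral>\<^sup>+x. h x * indicator {a..<b} x \<partial>lborel)" for a b and j :: int
    by (subst nn_integral_real_affine[where c = 1 and t = "of_int j * p"])
       (auto simp: perk intro!: nn_integral_cong split: split_indicator)
  have split: "(\<integral>\<^sup>+x. h x * indicator {a..<b} x \<partial>lborel) =
      (\<integral>\<^sup>+x. h x * indicator {a..<m} x \<partial>lborel) + (\<integral>\<^sup>+x. h x * indicator {m..<b} x \<partial>lborel)"
    if "a \<le> m" "m \<le> b" for a m b :: real
    using that by (subst nn_integral_add[symmetric])
       (auto intro!: nn_integral_cong split: split_indicator)
  have c: "c = of_int k * p + r" "c + p = of_int k * p + (r + p)" by (auto simp: r_def)
  have "(\<integral>\<^sup>+x. h x * indicator {c..<c + p} x \<partial>lborel) = (\<integral>\<^sup>+x. h x * indicator {r..<r + p} x \<partial>lborel)"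
    unfolding c(2) using shift[of k r "r + p"] c(1) by simp
  also have "\<dots> = (\<integral>\<^sup>+x. h x * indicator {r..<p} x \<partial>lborel) + (\<integral>\<^sup>+x. h x * indicator {p..<r + p} x \<partial>lborel)"
    using r by (intro split) auto
  also have "(\<integral>\<^sup>+x. h x * indicator {p..<r + p} x \<partial>lborel) = (\<integral>\<^sup>+x. h x * indicator {0..<r} x \<partial>lborel)"
    using shift[of 1 0 r] by (simp add: add.commute)
  finally show ?thesis
    using split[of 0 r p] r by (simp add: add.commute)
qed

section \<open>Differentiability of exponential forms in time\<close>

lemma exponential_form_differentiable:
  assumes "exponential_form Ct"
  shows "\<exists>g :: real \<Rightarrow> real. (\<forall>t. g differentiable (at t)) \<and> (\<forall>t\<ge>0. g t = Ct t x y)"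
proof -
  from assms obtain a E C where sm: "\<And>t. t \<ge> 0 \<Longrightarrow>
        summable (\<lambda>n. a ^ Suc n * t ^ Suc n / fact (Suc n) * markov_power C (Suc n) x y)"
    and eq: "\<And>t. t \<ge> 0 \<Longrightarrow> Ct t x y = exp (- (a * t)) *
          (E x y + (\<Sum>n. a ^ Suc n * t ^ Suc n / fact (Suc n) * markov_power C (Suc n) x y))"
    unfolding exponential_form_def by blast
  \<comment> \<open>The value of \<open>E\<close> becomes the constant coefficient, so that
    \<open>E\<close> and the series over \<open>Suc n\<close> merge into one power series.\<close>
  define c where "c n = (if n = 0 then E x y else a ^ n / fact n * markov_power C n x y)" for n
  have c_Suc: "c (Suc n) * t ^ Suc n = a ^ Suc n * t ^ Suc n / fact (Suc n) * markov_power C (Suc n) x y"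
    for n t by (simp add: c_def)
  have summ: "summable (\<lambda>n. c n * t ^ n)" if "t \<ge> 0" for t
    using sm[OF that] unfolding c_Suc[symmetric] by (subst (asm) summable_Suc_iff)
  define P where "P t = (\<Sum>n. c n * t ^ n)" for t
  have dP: "P differentiable (at t)" for t
  proof -
    \<comment> \<open>Summability is known at nonnegative points only. The point
      \<open>\<bar>t\<bar> + 1\<close> is one of them and puts every real \<open>t\<close>, negative
      or not, strictly inside the disc of convergence.\<close>
    have "summable (\<lambda>n. c n * (\<bar>t\<bar> + 1) ^ n)" by (rule summ) simp
    from termdiffs_strong[OF this, of t] show ?thesis
      unfolding P_def [abs_def] real_differentiable_def by auto
  qed
  have "exp (- (a * t)) * P t = Ct t x y" if "t \<ge> 0" for t
  proof -
    have "P t = E x y + (\<Sum>n. c (Suc n) * t ^ Suc n)"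
      unfolding P_def using suminf_split_head[OF summ[OF that]] by (simp add: c_def)
    then show ?thesis using eq[OF that] by (simp only: c_Suc)
  qed
  moreover have "(\<lambda>t. exp (- (a * t)) * P t) differentiable (at t)" for t
    by (intro differentiable_mult dP)
      (auto simp: real_differentiable_def intro!: exI derivative_eq_intros)
  ultimately show ?thesis by blast
qed


section \<open>Rotation invariance of the uniform law\<close>

lemma borel_measurable_frac [measurable]: "(frac :: real \<Rightarrow> real) \<in> borel_measurable borel"
  unfolding frac_def [abs_def] by measurable

text \<open>Translation by \<open>t\<close> carries \<open>{0..<1}\<close> to
  \<open>{t..<t + 1}\<close>, a full period of \<open>frac\<close>. This period may be replaced by
  \<open>{0..<1}\<close>, where \<open>frac\<close> is the identity.\<close>

lemma distr_unif01_rotation: "distr unif01 borel (\<lambda>u. frac (u + t)) = unif01"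
proof (rule measure_eqI)
  fix B assume "B \<in> sets (distr unif01 borel (\<lambda>u. frac (u + t)))"
  then have [measurable]: "B \<in> sets borel" by simp
  have "emeasure (distr unif01 borel (\<lambda>u. frac (u + t))) B =
      (\<integral>\<^sup>+v. indicator B v \<partial>distr unif01 borel (\<lambda>u. frac (u + t)))"
    by simp
  also have "\<dots> = (\<integral>\<^sup>+u. indicator B (frac (u + t)) \<partial>unif01)"
    by (rule nn_integral_distr) auto
  also have "\<dots> = (\<integral>\<^sup>+u. indicator B (frac (u + t)) * indicator {0..<1} u \<partial>lborel)"
    by (rule nn_integral_unif01) auto
  also have "\<dots> = (\<integral>\<^sup>+v. indicator B (frac v) * indicator {t..<t + 1} v \<partial>lborel)"
    by (subst (2) nn_integral_real_affine[where c = 1 and t = t])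
       (auto intro!: nn_integral_cong simp: add.commute split: split_indicator)
  also have "\<dots> = (\<integral>\<^sup>+v. indicator B (frac v) * indicator {0..<1} v \<partial>lborel)"
    by (rule nn_integral_period_shift) (auto simp: frac_1_eq)
  also have "\<dots> = (\<integral>\<^sup>+v. indicator B v * indicator {0..<1} v \<partial>lborel)"
    by (intro nn_integral_cong) (auto simp: frac_eq split: split_indicator)
  also have "\<dots> = emeasure unif01 B"
    by (subst nn_integral_unif01[where S = "{0..<1}", symmetric]) auto
  finally show "emeasure (distr unif01 borel (\<lambda>u. frac (u + t))) B = emeasure unif01 B" .
qed simp

section \<open>The folding map and the group generated by the reflections at 0 and 1\<close>

lemma fold01_cases:
  obtains k :: int where "fold01 x = x - 2 * of_int k" | k :: int where "fold01 x = 2 * of_int k - x"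
  unfolding fold01_def by (cases "x - 2 * of_int (round (x / 2)) \<ge> 0") auto

text \<open>Two even integers within distance 1 of \<open>x\<close> either coincide or have
  \<open>x\<close> as their midpoint, and in both cases the distances agree. The way
  \<open>round\<close> breaks ties therefore does not matter, and later computations may use any
  convenient \<open>k\<close>.\<close>

lemma fold01_eqI:
  assumes "\<bar>x - 2 * of_int k\<bar> \<le> 1"
  shows "fold01 x = \<bar>x - 2 * of_int k\<bar>"
proof -
  define m where "m = round (x / 2)"
  have "\<bar>of_int m - x / 2\<bar> \<le> 1 / 2" unfolding m_def by (rule of_int_round_abs_le)
  then have m: "\<bar>x - 2 * of_int m\<bar> \<le> 1" by linarith
  then have "\<bar>real_of_int m - of_int k\<bar> \<le> 1" using assms by linarith
  then have "\<bar>m - k\<bar> \<le> 1" by linarith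
  then consider "m = k" | "m = k + 1" | "m = k - 1" by linarith
  then show ?thesis
    unfolding fold01_def m_def[symmetric] using m assms by cases auto
qed

lemma fold01_unit: "0 \<le> x \<Longrightarrow> x \<le> 1 \<Longrightarrow> fold01 x = x"
  using fold01_eqI[of x 0] by simp

lemma fold01_round: "\<bar>x - 2 * of_int (round (x / 2))\<bar> \<le> 1"
  using of_int_round_abs_le[of "x / 2"] by linarith

lemma fold01_periodic: "fold01 (x + 2 * of_int k) = fold01 x"
  using fold01_eqI[of "x + 2 * of_int k" "round (x / 2) + k"] fold01_round[of x]
  by (simp add: fold01_def algebra_simps)

lemma fold01_minus: "fold01 (- x) = fold01 x"
proof -
  have "\<bar>- x - 2 * of_int (- round (x / 2))\<bar> = \<bar>x - 2 * of_int (round (x / 2))\<bar>"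
    by (simp add: abs_minus_commute)
  then show ?thesis
    using fold01_eqI[of "- x" "- round (x / 2)"] fold01_round[of x] by (simp add: fold01_def)
qed

lemma borel_measurable_fold01 [measurable]: "fold01 \<in> borel_measurable borel"
  unfolding fold01_def [abs_def] round_def by measurable

section \<open>Gaussian increments and the folded transition kernel\<close>

abbreviation gauss :: "real \<Rightarrow> real measure" where
  "gauss t \<equiv> density lborel (\<lambda>x. ennreal (normal_density 0 (sqrt t) x))"

lemma prob_space_gauss: "t > 0 \<Longrightarrow> prob_space (gauss t)"
  by (rule prob_space_normal_density) simp

lemma nn_integral_gauss_minus:
  assumes [measurable]: "f \<in> borel_measurable borel"
  shows "(\<integral>\<^sup>+g. f (- g) \<partial>gauss t) = (\<integral>\<^sup>+g. f g \<partial>gauss t)"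
  by (simp add: nn_integral_density)
     (subst (2) nn_integral_real_affine[where c = "- 1" and t = 0], simp_all add: normal_density_def)

text \<open>For \<open>t > 0\<close> this is the transition kernel of the reflected motion, written
  as a folded Gaussian law instead of a series over images. It is defined for every real start
  \<open>u\<close>, so that an unfolded position can be compared with its folded one.\<close>

definition fold_kernel :: "real \<Rightarrow> real set \<Rightarrow> real \<Rightarrow> ennreal" where
  "fold_kernel t B u = (\<integral>\<^sup>+g. indicator B (fold01 (u + g)) \<partial>gauss t)"

lemma borel_measurable_fold_kernel [measurable]:
  assumes "t > 0" and [measurable]: "B \<in> sets borel"
  shows "fold_kernel t B \<in> borel_measurable borel"
proof -
  interpret prob_space "gauss t" using assms(1) by (rule prob_space_gauss)
  show ?thesis unfolding fold_kernel_def [abs_def] by measurable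
qed

text \<open>This is why folding keeps the Markov property: the kernel sees only the folded position.
  If folding acts on \<open>w\<close> as an even translation, the period of \<open>fold01\<close>
  absorbs it; if it acts as a reflection, evenness of \<open>fold01\<close> moves the sign to the
  increment, whose law is symmetric.\<close>

lemma fold_kernel_fold01:
  assumes [measurable]: "B \<in> sets borel"
  shows "fold_kernel t B (fold01 w) = fold_kernel t B w"
proof (cases w rule: fold01_cases)
  case (1 k)
  have "fold01 (fold01 w + g) = fold01 (w + g)" for g
    using fold01_periodic[of "w + g" "- k"] by (simp add: 1 algebra_simps)
  then show ?thesis by (simp add: fold_kernel_def)
next
  case (2 k)
  have "fold01 (fold01 w + g) = fold01 (w + - g)" for g
    using fold01_periodic[of "g - w" k] fold01_minus[of "w - g"] by (simp add: 2 algebra_simps)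
  then have "fold_kernel t B (fold01 w) = (\<integral>\<^sup>+g. indicator B (fold01 (w + - g)) \<partial>gauss t)"
    by (simp add: fold_kernel_def)
  also have "\<dots> = fold_kernel t B w"
    unfolding fold_kernel_def
    by (rule nn_integral_gauss_minus[where f = "\<lambda>g. indicator B (fold01 (w + g))"]) simp
  finally show ?thesis .
qed

text \<open>A single shift need not preserve the uniform law: folding \<open>u + 1 / 2\<close> never
  gives a value below 1/2. Two opposite shifts together do. Since \<open>fold01\<close> is even,
  \<open>u - g\<close> may be replaced by \<open>g - u\<close>, and the images of the unit interval
  under \<open>u + g\<close> and \<open>g - u\<close> are adjacent and fill one period of length
  2.\<close>

lemma nn_integral_fold01_shifts:
  assumes [measurable]: "B \<in> sets borel"
  shows "(\<integral>\<^sup>+u. indicator B (fold01 (u + g)) \<partial>unif01) + (\<integral>\<^sup>+u. indicator B (fold01 (u + - g)) \<partial>unif01)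
    = 2 * emeasure unif01 B"
proof -
  let ?H = "\<lambda>v. indicator B (fold01 v) :: ennreal"
  let ?G = "\<lambda>g. \<integral>\<^sup>+u. ?H (u + g) \<partial>unif01"
  have sum: "?G g + ?G (- g) = (\<integral>\<^sup>+v. ?H v * indicator {0..<2} v \<partial>lborel)" for g
  proof -
    have "?G g = (\<integral>\<^sup>+u. ?H (u + g) * indicator {0..<1} u \<partial>lborel)"
      by (rule nn_integral_unif01) auto
    also have "\<dots> = (\<integral>\<^sup>+v. ?H v * indicator {g..<g + 1} v \<partial>lborel)"
      by (subst (2) nn_integral_real_affine[where c = 1 and t = g])
         (auto intro!: nn_integral_cong simp: add.commute split: split_indicator)
    finally have 1: "?G g = (\<integral>\<^sup>+v. ?H v * indicator {g..<g + 1} v \<partial>lborel)" .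
    have eq: "fold01 (u + - g) = fold01 (g - u)" for u
      using fold01_minus[of "u - g"] by simp
    \<comment> \<open>The left endpoint is dropped here because \<open>g - u\<close> reverses
      orientation: it maps \<open>{0<..1}\<close> onto \<open>{g - 1..<g}\<close>, which meets
      \<open>{g..<g + 1}\<close> without overlap.\<close>
    have "?G (- g) = (\<integral>\<^sup>+u. ?H (u + - g) * indicator {0<..1} u \<partial>lborel)"
      by (rule nn_integral_unif01) auto
    also have "\<dots> = (\<integral>\<^sup>+v. ?H v * indicator {g - 1..<g} v \<partial>lborel)"
      unfolding eq
      by (subst (2) nn_integral_real_affine[where c = "- 1" and t = g])
         (auto intro!: nn_integral_cong split: split_indicator)
    finally have 2: "?G (- g) = (\<integral>\<^sup>+v. ?H v * indicator {g - 1..<g} v \<partial>lborel)" .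
    have "?G g + ?G (- g) = (\<integral>\<^sup>+v. ?H v * indicator {g - 1..<g - 1 + 2} v \<partial>lborel)"
      unfolding 1 2
      by (subst nn_integral_add[symmetric])
         (auto intro!: nn_integral_cong split: split_indicator)
    also have "\<dots> = (\<integral>\<^sup>+v. ?H v * indicator {0..<2} v \<partial>lborel)"
      using fold01_periodic[of _ 1] by (intro nn_integral_period_shift) auto
    finally show ?thesis .
  qed
  \<comment> \<open>The sum is the same for all \<open>g\<close>; the unshifted case
    \<open>g = 0\<close>, where folding does nothing, gives its value.\<close>
  have "?G 0 = (\<integral>\<^sup>+u. ?H u * indicator {0..1} u \<partial>lborel)"
    by (subst nn_integral_unif01[where S = "{0..1}"]) auto
  also have "\<dots> = (\<integral>\<^sup>+u. indicator B u * indicator {0..1} u \<partial>lborel)"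
    by (intro nn_integral_cong) (auto simp: fold01_unit split: split_indicator)
  also have "\<dots> = emeasure unif01 B"
    by (subst nn_integral_unif01[where S = "{0..1}", symmetric]) auto
  finally have "?G 0 = emeasure unif01 B" .
  then show ?thesis using sum[of g] sum[of 0] by (simp add: mult_2)
qed

text \<open>Invariance of the uniform law. By Fubini the integral is a Gaussian average of
  \<open>?G g\<close>, and by symmetry also of \<open>?G (- g)\<close>. Adding the two gives twice
  the integral, to which the identity for opposite shifts applies.\<close>

lemma nn_integral_fold_kernel:
  assumes t: "t > 0" and [measurable]: "B \<in> sets borel"
  shows "(\<integral>\<^sup>+u. fold_kernel t B u \<partial>unif01) = emeasure unif01 B"
proof -
  interpret G: prob_space "gauss t" using t by (rule prob_space_gauss)
  interpret U: prob_space unif01 by (rule prob_space_unif01)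
  interpret pair_sigma_finite unif01 "gauss t" ..
  let ?I = "\<integral>\<^sup>+u. fold_kernel t B u \<partial>unif01"
  let ?G = "\<lambda>g. \<integral>\<^sup>+u. indicator B (fold01 (u + g)) \<partial>unif01"
  have [measurable]: "?G \<in> borel_measurable borel" by measurable
  have I: "?I = (\<integral>\<^sup>+g. ?G g \<partial>gauss t)"
    unfolding fold_kernel_def by (rule Fubini'[symmetric]) measurable
  then have I': "?I = (\<integral>\<^sup>+g. ?G (- g) \<partial>gauss t)"
    by (subst nn_integral_gauss_minus) auto
  have "2 * ?I = (\<integral>\<^sup>+g. ?G g \<partial>gauss t) + (\<integral>\<^sup>+g. ?G (- g) \<partial>gauss t)"
    unfolding mult_2 using I I' by metis
  also have "\<dots> = (\<integral>\<^sup>+g. ?G g + ?G (- g) \<partial>gauss t)"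
    by (rule nn_integral_add[symmetric]) auto
  also have "\<dots> = (\<integral>\<^sup>+g. 2 * emeasure unif01 B \<partial>gauss t)"
    by (subst nn_integral_fold01_shifts) auto
  also have "\<dots> = 2 * emeasure unif01 B"
    using G.emeasure_space_1 by (subst nn_integral_const) simp
  finally show ?thesis by (simp add: ennreal_mult_cancel_left)
qed

section \<open>Two-time laws of reflected Brownian motion\<close>

lemma brownian_fold_joint:
  assumes bm: "brownian_motion 1 N W" and st: "s \<ge> 0" "t > 0"
    and [measurable]: "A \<in> sets borel" "B \<in> sets borel"
  shows "emeasure N {\<omega> \<in> space N. fold01 (W s \<omega>) \<in> A \<and> fold01 (W (s + t) \<omega>) \<in> B} =
    (\<integral>\<^sup>+u. indicator A u * fold_kernel t B u \<partial>distr N borel (\<lambda>\<omega>. fold01 (W s \<omega>)))"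
proof -
  interpret prob_space N using bm by (simp add: brownian_motion_def)
  have W [measurable]: "W r \<in> borel_measurable N" if "r \<ge> 0" for r
    using bm that by (simp add: brownian_motion_def)
  have [measurable]: "W s \<in> borel_measurable N" "W (s + t) \<in> borel_measurable N"
    using st by (auto intro: W)
  define D where "D \<omega> = W (s + t) \<omega> - W s \<omega>" for \<omega>
  have D [measurable]: "D \<in> borel_measurable N" unfolding D_def [abs_def] by measurable
  have bm_s: "\<forall>t>s. distributed N lborel (\<lambda>\<omega>. W t \<omega> - W s \<omega>) (normal_density 0 (1 * sqrt (t - s))) \<and>
        indep_set (sets (past N {0..} W s))
          (sets (vimage_algebra (space N) (\<lambda>\<omega>. W t \<omega> - W s \<omega>) borel))"
    using bm st(1) unfolding brownian_motion_def by blast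
  have "s < s + t" using st by simp
  from bm_s[rule_format, OF this]
  have dist: "distributed N lborel D (normal_density 0 (sqrt t))"
    and ind: "indep_set (sets (past N {0..} W s)) (sets (vimage_algebra (space N) D borel))"
    by (simp_all add: D_def [abs_def])
  have "distr N borel D = distr N lborel D" by (rule distr_cong) auto
  also have "\<dots> = gauss t" by (rule distributed_distr_eq_density[OF dist])
  finally have dD: "distr N borel D = gauss t" .
  \<comment> \<open>Increments are independent of the whole past up to \<open>s\<close>; time
    \<open>s\<close> itself belongs to that past, so independence of \<open>W s\<close> follows by
    restriction.\<close>
  have sub: "sigma_sets (space N) {W s -` A \<inter> space N |A. A \<in> sets borel} \<subseteq> sets (past N {0..} W s)"
  proof -
    have "{W u -` A \<inter> space N |u A. u \<in> {0..} \<and> u \<le> s \<and> A \<in> sets borel} \<subseteq> Pow (space N)" by auto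
    then show ?thesis
      unfolding past_def using st(1) by (simp add: sets_measure_of) (rule sigma_sets_mono', auto)
  qed
  have "indep_set (sigma_sets (space N) {W s -` A \<inter> space N |A. A \<in> sets borel})
      (sigma_sets (space N) {D -` A \<inter> space N |A. A \<in> sets borel})"
    using ind sub by (fastforce simp: indep_sets2_eq sets_vimage_algebra)
  then have "indep_var borel (W s) borel D"
    unfolding indep_var_eq by auto
  then have pair: "distr N (borel \<Otimes>\<^sub>M borel) (\<lambda>\<omega>. (W s \<omega>, D \<omega>)) = distr N borel (W s) \<Otimes>\<^sub>M gauss t"
    unfolding indep_var_distribution_eq dD by simp
  interpret G: prob_space "gauss t" using st by (intro prob_space_gauss)
  interpret D: prob_space "distr N borel (W s)" by (rule prob_space_distr) simp
  let ?f = "\<lambda>(w, g). indicator A (fold01 w) * indicator B (fold01 (w + g)) :: ennreal"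
  have "emeasure N {\<omega> \<in> space N. fold01 (W s \<omega>) \<in> A \<and> fold01 (W (s + t) \<omega>) \<in> B} =
      (\<integral>\<^sup>+\<omega>. indicator {\<omega> \<in> space N. fold01 (W s \<omega>) \<in> A \<and> fold01 (W (s + t) \<omega>) \<in> B} \<omega> \<partial>N)"
    by (rule nn_integral_indicator[symmetric]) measurable
  also have "\<dots> = (\<integral>\<^sup>+\<omega>. ?f (W s \<omega>, D \<omega>) \<partial>N)"
    by (intro nn_integral_cong) (auto simp: D_def split: split_indicator)
  also have "\<dots> = (\<integral>\<^sup>+p. ?f p \<partial>distr N (borel \<Otimes>\<^sub>M borel) (\<lambda>\<omega>. (W s \<omega>, D \<omega>)))"
    by (rule nn_integral_distr[symmetric]) measurable
  also have "\<dots> = (\<integral>\<^sup>+w. \<integral>\<^sup>+g. ?f (w, g) \<partial>gauss t \<partial>distr N borel (W s))"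
    unfolding pair by (rule G.nn_integral_fst[symmetric]) measurable
  \<comment> \<open>Integrating out the increment leaves the kernel at \<open>w\<close>, which
    equals the kernel at \<open>fold01 w\<close>. From here the integrand depends on the folded
    position alone.\<close>
  also have "\<dots> = (\<integral>\<^sup>+w. indicator A (fold01 w) * fold_kernel t B (fold01 w) \<partial>distr N borel (W s))"
    unfolding fold_kernel_fold01[OF assms(5)] unfolding fold_kernel_def
    by (intro nn_integral_cong) (simp add: nn_integral_cmult)
  also have "\<dots> = (\<integral>\<^sup>+\<omega>. indicator A (fold01 (W s \<omega>)) * fold_kernel t B (fold01 (W s \<omega>)) \<partial>N)"
    using borel_measurable_fold_kernel[OF st(2) assms(5), measurable] by (intro nn_integral_distr) auto
  also have "\<dots> = (\<integral>\<^sup>+u. indicator A u * fold_kernel t B u \<partial>distr N borel (\<lambda>\<omega>. fold01 (W s \<omega>)))"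
    using borel_measurable_fold_kernel[OF st(2) assms(5), measurable]
    by (intro nn_integral_distr[symmetric]) auto
  finally show ?thesis .
qed

text \<open>An event about two times is the preimage of a measurable cylinder \<open>S\<close> of
  the path space, so the law of the process determines its probability.\<close>

lemma process_law_eq_imp_joint_eq:
  assumes [measurable]: "\<And>r. r \<ge> 0 \<Longrightarrow> X r \<in> borel_measurable M" "\<And>r. r \<ge> 0 \<Longrightarrow> Y r \<in> borel_measurable N"
    and law: "process_law M X = process_law N Y"
    and st: "s \<ge> 0" "t \<ge> 0" and [measurable]: "A \<in> sets borel" "B \<in> sets borel"
  shows "emeasure M {\<omega> \<in> space M. X s \<omega> \<in> A \<and> X t \<omega> \<in> B} = emeasure N {\<omega> \<in> space N. Y s \<omega> \<in> A \<and> Y t \<omega> \<in> B}"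
proof -
  define S where "S = {x \<in> space (\<Pi>\<^sub>M r\<in>{0::real..}. (borel :: real measure)). x s \<in> A \<and> x t \<in> B}"
  have [measurable]: "(\<lambda>x. x s) \<in> borel_measurable (\<Pi>\<^sub>M r\<in>{0::real..}. (borel :: real measure))"
      "(\<lambda>x. x t) \<in> borel_measurable (\<Pi>\<^sub>M r\<in>{0::real..}. (borel :: real measure))"
    using st by (auto intro: measurable_component_singleton)
  have S: "S \<in> sets (\<Pi>\<^sub>M r\<in>{0::real..}. (borel :: real measure))" unfolding S_def by measurable
  \<comment> \<open>The sample space of \<open>Q\<close> has an arbitrary type, since the fact is
    applied to both \<open>M\<close> and \<open>N\<close>.\<close>
  have *: "emeasure (process_law Q Z) S = emeasure Q {\<omega> \<in> space Q. Z s \<omega> \<in> A \<and> Z t \<omega> \<in> B}"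
    if "\<And>r. r \<ge> 0 \<Longrightarrow> Z r \<in> borel_measurable Q" for Q :: "'c measure" and Z
  proof -
    have m: "(\<lambda>\<omega>. \<lambda>r\<in>{0..}. Z r \<omega>) \<in> Q \<rightarrow>\<^sub>M (\<Pi>\<^sub>M r\<in>{0::real..}. borel)"
      using that by (intro measurable_restrict) auto
    show ?thesis
      unfolding process_law_def emeasure_distr[OF m S] using st
      by (intro arg_cong[where f = "emeasure Q"]) (auto simp: S_def space_PiM)
  qed
  show ?thesis using *[of X M] *[of Y N] assms(1,2) law by auto
qed

text \<open>Everything is computed for the folded Brownian motion \<open>Y\<close> on
  \<open>N\<close> and carried over by equality of laws. In particular the uniform start of
  \<open>U\<close> is inherited by \<open>Y 0\<close>, and the kernel then keeps it uniform.\<close>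

lemma reflected_brownian_motion_joint:
  assumes rbm: "reflected_brownian_motion 1 M U" and unif: "uniform_rv M (U 0)" and s: "s \<ge> 0"
  shows reflected_brownian_motion_uniform: "uniform_rv M (U s)"
    and "\<And>t A B. t > 0 \<Longrightarrow> A \<in> sets borel \<Longrightarrow> B \<in> sets borel \<Longrightarrow>
      emeasure M {\<omega> \<in> space M. U s \<omega> \<in> A \<and> U (s + t) \<omega> \<in> B} =
      (\<integral>\<^sup>+u. indicator A u * fold_kernel t B u \<partial>unif01)"
proof -
  from rbm obtain N :: "(real \<Rightarrow> real) measure" and W where bm: "brownian_motion 1 N W"
    and law: "process_law M U = process_law N (\<lambda>t \<omega>. fold01 (W t \<omega>))"
    and U: "\<And>t. t \<ge> 0 \<Longrightarrow> U t \<in> borel_measurable M"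
    unfolding reflected_brownian_motion_def by blast
  define Y where "Y t \<omega> = fold01 (W t \<omega>)" for t \<omega>
  have W: "W t \<in> borel_measurable N" if "t \<ge> 0" for t
    using bm that by (simp add: brownian_motion_def)
  have Y: "Y t \<in> borel_measurable N" if "t \<ge> 0" for t
    using W[OF that] unfolding Y_def [abs_def] by measurable
  have joint: "emeasure M {\<omega> \<in> space M. U r \<omega> \<in> A \<and> U t \<omega> \<in> B} =
      emeasure N {\<omega> \<in> space N. Y r \<omega> \<in> A \<and> Y t \<omega> \<in> B}"
    if "r \<ge> 0" "t \<ge> 0" "A \<in> sets borel" "B \<in> sets borel" for r t A B
    using U Y law[folded Y_def] that by (intro process_law_eq_imp_joint_eq)
  have distr_eq: "distr M borel (U t) = distr N borel (Y t)" if t: "t \<ge> 0" for t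
  proof (rule measure_eqI)
    fix B assume "B \<in> sets (distr M borel (U t))"
    then have B: "B \<in> sets borel" by simp
    show "emeasure (distr M borel (U t)) B = emeasure (distr N borel (Y t)) B"
      using joint[OF t t B, of UNIV] t
      by (simp add: emeasure_distr U Y B vimage_def Int_def conj_commute)
  qed simp
  have Y0: "distr N borel (Y 0) = unif01"
    using distr_eq[of 0] unif by (simp add: uniform_rv_def)
  have kernel: "emeasure N {\<omega> \<in> space N. Y r \<omega> \<in> A \<and> Y (r + t) \<omega> \<in> B} =
      (\<integral>\<^sup>+u. indicator A u * fold_kernel t B u \<partial>distr N borel (Y r))"
    if "r \<ge> 0" "t > 0" "A \<in> sets borel" "B \<in> sets borel" for r t A B
    using brownian_fold_joint[OF bm that] by (simp add: Y_def [abs_def])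
  \<comment> \<open>The kernel needs positive elapsed time, so time 0 is separate. For later
    \<open>s\<close> a single transition from time 0, with no restriction on the start, gives the
    marginal law.\<close>
  have Ys: "distr N borel (Y s) = unif01"
  proof (cases "s = 0")
    case False
    then have s: "s > 0" using \<open>s \<ge> 0\<close> by simp
    show ?thesis
    proof (rule measure_eqI)
      fix B assume "B \<in> sets (distr N borel (Y s))"
      then have B: "B \<in> sets borel" by simp
      have "emeasure (distr N borel (Y s)) B = emeasure N {\<omega> \<in> space N. Y 0 \<omega> \<in> UNIV \<and> Y (0 + s) \<omega> \<in> B}"
        using s by (simp add: emeasure_distr Y B vimage_def Int_def conj_commute)
      also have "\<dots> = (\<integral>\<^sup>+u. fold_kernel s B u \<partial>unif01)"
        using kernel[of 0 s UNIV B] s B Y0 by simp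
      finally show "emeasure (distr N borel (Y s)) B = emeasure unif01 B"
        using nn_integral_fold_kernel[OF s B] by simp
    qed simp
  qed (simp add: Y0)
  show "uniform_rv M (U s)"
    using U[OF s] distr_eq[OF s] Ys by (simp add: uniform_rv_def)
  show "emeasure M {\<omega> \<in> space M. U s \<omega> \<in> A \<and> U (s + t) \<omega> \<in> B} =
      (\<integral>\<^sup>+u. indicator A u * fold_kernel t B u \<partial>unif01)"
    if "t > 0" "A \<in> sets borel" "B \<in> sets borel" for t A B
    using joint[of s "s + t" A B] kernel[of s t A B] that s Ys by simp
qed

lemma reflected_brownian_motion_stationary:
  assumes rbm: "reflected_brownian_motion 1 M U" and unif: "uniform_rv M (U 0)"
    and s: "s \<ge> 0" and t: "t \<ge> 0"
  shows "joint_cdf M (U s) (U (s + t)) = joint_cdf M (U 0) (U t)"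
proof (intro ext)
  fix x y
  show "joint_cdf M (U s) (U (s + t)) x y = joint_cdf M (U 0) (U t) x y"
  proof (cases "t = 0")
    \<comment> \<open>Without elapsed time the joint law lies on the diagonal and is determined by
      the marginal, which is uniform at every time.\<close>
    case True
    have "joint_cdf M (U r) (U r) x y = measure unif01 {..min x y}" if r: "r \<ge> 0" for r
    proof -
      have u: "U r \<in> borel_measurable M" "distr M borel (U r) = unif01"
        using reflected_brownian_motion_uniform[OF rbm unif r] by (auto simp: uniform_rv_def)
      show ?thesis
        unfolding joint_cdf_def u(2)[symmetric] using u(1)
        by (subst measure_distr) (auto intro!: arg_cong[where f = "measure M"])
    qed
    then show ?thesis using True s by simp
  next
    case False
    then have t: "t > 0" using t by simp
    show ?thesis
      using reflected_brownian_motion_joint(2)[OF rbm unif s t, of "{..x}" "{..y}"]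
        reflected_brownian_motion_joint(2)[OF rbm unif order_refl t, of "{..x}" "{..y}"]
      by (simp add: joint_cdf_def measure_def)
  qed
qed

section \<open>Crossing the level 1/2 in a short time\<close>

lemma fold_kernel_crossing:
  assumes t: "t > 0" "sqrt t \<le> 1 / 4" and u: "1 / 2 - sqrt t < u" "u \<le> 1 / 2"
  shows "ennreal (exp (- 2) / sqrt (2 * pi)) \<le> fold_kernel t {1 / 2<..} u"
proof -
  \<comment> \<open>Only increments between one and two standard deviations \<open>r\<close> are
    counted. They carry \<open>u\<close> above 1/2, and since \<open>r \<le> 1 / 4\<close> they do
    not carry it beyond 1, so no folding occurs. The density there is at least
    \<open>exp (- 2) / sqrt (2 * pi) / r\<close> on a window of length \<open>r\<close>, and the
    factor \<open>r\<close> cancels.\<close>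
  define r where "r = sqrt t"
  have r: "r > 0" "r \<le> 1 / 4" using t by (auto simp: r_def)
  have dens: "exp (- 2) / sqrt (2 * pi) / r \<le> normal_density 0 r g" if g: "r < g" "g \<le> 2 * r" for g
  proof -
    have "g\<^sup>2 \<le> (2 * r)\<^sup>2" using g r by (intro power_mono) auto
    then have "- 2 \<le> - (g\<^sup>2) / (2 * r\<^sup>2)" using r by (simp add: field_simps)
    moreover have "sqrt (2 * pi * r\<^sup>2) = sqrt (2 * pi) * r" using r by (simp add: real_sqrt_mult)
    ultimately show ?thesis
      using r by (simp add: normal_density_def divide_right_mono)
  qed
  have "ennreal (exp (- 2) / sqrt (2 * pi)) =
      (\<integral>\<^sup>+g. ennreal (exp (- 2) / sqrt (2 * pi) / r) * indicator {r<..2 * r} g \<partial>lborel)"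
    using r by (simp add: nn_integral_cmult_indicator ennreal_mult'[symmetric])
  also have "\<dots> \<le> (\<integral>\<^sup>+g. ennreal (normal_density 0 r g) * indicator {1 / 2<..} (fold01 (u + g)) \<partial>lborel)"
  proof (intro nn_integral_mono)
    fix g
    show "ennreal (exp (- 2) / sqrt (2 * pi) / r) * indicator {r<..2 * r} g \<le>
        ennreal (normal_density 0 r g) * indicator {1 / 2<..} (fold01 (u + g))"
    proof (cases "g \<in> {r<..2 * r}")
      case True
      then have "fold01 (u + g) = u + g" "u + g > 1 / 2"
        using u r by (auto simp: r_def[symmetric] intro!: fold01_unit)
      then show ?thesis using True dens[of g] by (simp add: ennreal_leI)
    qed simp
  qed
  also have "\<dots> = fold_kernel t {1 / 2<..} u"
    unfolding fold_kernel_def r_def by (simp add: nn_integral_density)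
  finally show ?thesis .
qed

text \<open>Starting points in a strip of width \<open>sqrt t\<close> below 1/2 cross with
  probability bounded below uniformly in \<open>t\<close>. The mass that crosses is missing from the
  probability 1/2 of starting at or below 1/2.\<close>

lemma reflected_brownian_motion_crossing:
  assumes rbm: "reflected_brownian_motion 1 M U" and unif: "uniform_rv M (U 0)"
    and t: "t > 0" "sqrt t \<le> 1 / 4"
  shows "joint_cdf M (U 0) (U t) (1 / 2) (1 / 2) \<le> 1 / 2 - exp (- 2) / sqrt (2 * pi) * sqrt t"
proof -
  interpret prob_space M using rbm by (simp add: reflected_brownian_motion_def)
  have [measurable]: "U 0 \<in> borel_measurable M" "U t \<in> borel_measurable M"
    using rbm t by (auto simp: reflected_brownian_motion_def)
  let ?c = "exp (- 2) / sqrt (2 * pi)"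
  let ?A = "{\<omega> \<in> space M. U 0 \<omega> \<le> 1 / 2 \<and> U t \<omega> \<le> 1 / 2}"
  let ?B = "{\<omega> \<in> space M. U 0 \<omega> \<le> 1 / 2 \<and> U t \<omega> > 1 / 2}"
  have "ennreal (?c * sqrt t) =
      (\<integral>\<^sup>+u. ennreal ?c * indicator {1 / 2 - sqrt t<..1 / 2} u \<partial>lborel)"
    using t by (simp add: nn_integral_cmult_indicator ennreal_mult'[symmetric])
  also have "\<dots> = (\<integral>\<^sup>+u. ennreal ?c * indicator {1 / 2 - sqrt t<..1 / 2} u * indicator {0..1} u \<partial>lborel)"
    using t by (intro nn_integral_cong) (auto split: split_indicator)
  also have "\<dots> = (\<integral>\<^sup>+u. ennreal ?c * indicator {1 / 2 - sqrt t<..1 / 2} u \<partial>unif01)"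
    by (rule nn_integral_unif01[symmetric]) auto
  also have "\<dots> \<le> (\<integral>\<^sup>+u. indicator {..1 / 2} u * fold_kernel t {1 / 2<..} u \<partial>unif01)"
    using fold_kernel_crossing[OF t] by (intro nn_integral_mono) (auto split: split_indicator)
  also have "\<dots> = emeasure M ?B"
    using reflected_brownian_motion_joint(2)[OF rbm unif order_refl t(1), of "{..1 / 2}" "{1 / 2<..}"]
    by simp
  finally have B: "?c * sqrt t \<le> prob ?B"
    using t by (simp add: emeasure_eq_measure)
  have "prob ?A + prob ?B = prob (?A \<union> ?B)"
    by (rule finite_measure_Union[symmetric]) auto
  also have "?A \<union> ?B = {\<omega> \<in> space M. U 0 \<omega> \<le> 1 / 2}" by auto
  also have "prob \<dots> = 1 / 2" using unif by (rule uniform_rv_measure_le_half)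
  finally show ?thesis using B by (simp add: joint_cdf_def)
qed

lemma reflected_brownian_motion_not_exponential_form:
  assumes rbm: "reflected_brownian_motion 1 M U" and unif: "uniform_rv M (U 0)"
  shows "\<not> exponential_form (\<lambda>t. joint_cdf M (U 0) (U t))"
proof
  assume "exponential_form (\<lambda>t. joint_cdf M (U 0) (U t))"
  then obtain g where g: "\<And>t. g differentiable (at t)"
    and g_eq: "\<And>t. t \<ge> 0 \<Longrightarrow> g t = joint_cdf M (U 0) (U t) (1 / 2) (1 / 2)"
    using exponential_form_differentiable[of _ "1 / 2" "1 / 2"] by blast
  have g0: "g 0 = 1 / 2"
    using uniform_rv_measure_le_half[OF unif] by (simp add: g_eq joint_cdf_def)
  define c :: real where "c = exp (- 2) / sqrt (2 * pi)"
  have c: "c > 0" by (simp add: c_def)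
  from g[of 0] obtain D where "(g has_real_derivative D) (at 0)"
    by (auto simp: real_differentiable_def)
  then have "(\<lambda>h. (g (0 + h) - g 0) / h) \<midarrow>0\<rightarrow> D" by (simp add: DERIV_def)
  from LIM_D[OF this zero_less_one] obtain d where d: "d > 0"
    and D: "\<And>h. h \<noteq> 0 \<Longrightarrow> \<bar>h\<bar> < d \<Longrightarrow> \<bar>(g h - g 0) / h - D\<bar> < 1" by auto
  \<comment> \<open>The difference quotient is tested at time \<open>r\<^sup>2\<close>, where the
    loss is at least \<open>c * r\<close> and the quotient at most \<open>- c / r\<close>. The three
    bounds on \<open>r\<close> serve the crossing estimate, the inequality
    \<open>r\<^sup>2 < d\<close>, and \<open>c / r \<ge> \<bar>D\<bar> + 1\<close>.\<close>
  define r where "r = min (1 / 4) (min (d / 2) (c / (\<bar>D\<bar> + 1)))"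
  have r: "r \<le> 1 / 4" "r \<le> d / 2" "r \<le> c / (\<bar>D\<bar> + 1)"
    unfolding r_def by linarith+
  have "r > 0" using d c by (simp add: r_def)
  note r = this r
  have "r\<^sup>2 \<le> r" using r by (simp add: power2_eq_square mult_left_le)
  then have "\<bar>(g (r\<^sup>2) - g 0) / r\<^sup>2 - D\<bar> < 1" using r d by (intro D) auto
  moreover have "(g (r\<^sup>2) - g 0) / r\<^sup>2 \<le> - (\<bar>D\<bar> + 1)"
  proof -
    have "g (r\<^sup>2) - g 0 \<le> - (c * r)"
      using reflected_brownian_motion_crossing[OF rbm unif, of "r\<^sup>2"] r
      unfolding c_def by (simp add: g_eq[of "r\<^sup>2"] g0)
    moreover have "(\<bar>D\<bar> + 1) * r \<le> c" using r by (simp add: field_simps)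
    then have "(\<bar>D\<bar> + 1) * r * r \<le> c * r" using r by (intro mult_right_mono) auto
    ultimately show ?thesis using r by (simp add: field_simps power2_eq_square)
  qed
  ultimately show False by linarith
qed

section \<open>Deterministic flows as Markov processes\<close>

lemma real_cond_exp_measurable_indicator:
  assumes "prob_space M" and F: "subalgebra M F" and X: "X \<in> borel_measurable F" and A: "A \<in> sets borel"
  shows "AE \<omega> in M. real_cond_exp M F (\<lambda>\<omega>. indicator A (X \<omega>)) \<omega> = indicator A (X \<omega>)"
proof -
  interpret prob_space M by fact
  interpret finite_measure_subalgebra M F by unfold_locales (rule F)
  have F': "(\<lambda>\<omega>. indicator A (X \<omega>) :: real) \<in> borel_measurable F" using X A by measurable
  then have "(\<lambda>\<omega>. indicator A (X \<omega>) :: real) \<in> borel_measurable M"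
    by (rule measurable_from_subalg[OF F])
  then have "integrable M (\<lambda>\<omega>. indicator A (X \<omega>) :: real)"
    by (intro integrable_const_bound[where B = 1]) (auto split: split_indicator)
  then show ?thesis using F' by (rule real_cond_exp_F_meas)
qed

text \<open>A later state is a measurable function of the present one, hence measurable for the past
  as well as for the present. Both conditional probabilities are then the indicator itself, and the
  transition kernel is the point mass at \<open>f t x\<close>.\<close>

lemma deterministic_flow_markov:
  assumes "prob_space M" and X: "\<And>t. t \<ge> 0 \<Longrightarrow> X t \<in> borel_measurable M"
    and f: "\<And>t. t \<ge> 0 \<Longrightarrow> f t \<in> borel_measurable borel"
    and flow: "\<And>s t \<omega>. s \<ge> 0 \<Longrightarrow> t \<ge> 0 \<Longrightarrow> X (s + t) \<omega> = f t (X s \<omega>)"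
  shows "time_homogeneous_markov_process M X"
proof -
  interpret prob_space M by fact
  have sub_past: "subalgebra M (past M {0..} X s)" for s
  proof -
    have "{X u -` A \<inter> space M |u A. u \<in> {0..} \<and> u \<le> s \<and> A \<in> sets borel} \<subseteq> sets M"
      using X by auto
    then show ?thesis
      by (auto simp: subalgebra_def past_def sets_measure_of_conv space_measure_of_conv
            dest: sets.sigma_sets_subset)
  qed
  have sub_now: "subalgebra M (vimage_algebra (space M) (X s) borel)" if "s \<ge> 0" for s
    using X[OF that] sets_vimage_algebra2[of "X s" "space M" borel] by (auto simp: subalgebra_def)
  have X_past: "X s \<in> borel_measurable (past M {0..} X s)" if "s \<ge> 0" for s
  proof -
    have "{X u -` A \<inter> space M |u A. u \<in> {0..} \<and> u \<le> s \<and> A \<in> sets borel} \<subseteq> Pow (space M)" by auto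
    moreover have "X s -` A \<inter> space M \<in> {X u -` A \<inter> space M |u A. u \<in> {0..} \<and> u \<le> s \<and> A \<in> sets borel}"
      if "A \<in> sets borel" for A using that \<open>s \<ge> 0\<close> by auto
    ultimately show ?thesis
      unfolding measurable_def past_def by (auto simp: sets_measure_of)
  qed
  have X_now: "X s \<in> borel_measurable (vimage_algebra (space M) (X s) borel)" for s
    by (rule measurable_vimage_algebra1) auto
  have later: "X (s + t) \<in> borel_measurable F"
    if "s \<ge> 0" "t \<ge> 0" "X s \<in> borel_measurable F" for s t and F :: "'a measure"
  proof -
    have "X (s + t) = (\<lambda>\<omega>. f t (X s \<omega>))" using flow that by auto
    then show ?thesis using measurable_compose[OF that(3) f[OF that(2)]] by simp
  qed
  have past: "AE \<omega> in M. real_cond_exp M (past M {0..} X s) (\<lambda>\<omega>. indicator A (X (s + t) \<omega>)) \<omega> =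
      indicator A (X (s + t) \<omega>)" if "s \<ge> 0" "t \<ge> 0" "A \<in> sets borel" for s t A
    using that \<open>prob_space M\<close> by (intro real_cond_exp_measurable_indicator sub_past later X_past)
  have now: "AE \<omega> in M. real_cond_exp M (vimage_algebra (space M) (X s) borel)
      (\<lambda>\<omega>. indicator A (X (s + t) \<omega>)) \<omega> = indicator A (X (s + t) \<omega>)"
    if "s \<ge> 0" "t \<ge> 0" "A \<in> sets borel" for s t A
    using that \<open>prob_space M\<close> by (intro real_cond_exp_measurable_indicator sub_now later X_now)
  have "markov_process M {0..} X"
    unfolding markov_process_def
  proof (intro conjI ballI impI)
    fix s t :: real and A :: "real set" assume st: "s \<in> {0..}" "t \<in> {0..}" "s \<le> t" and A: "A \<in> sets borel"
    show "AE \<omega> in M. real_cond_exp M (past M {0..} X s) (\<lambda>\<omega>. indicator A (X t \<omega>)) \<omega> =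
        real_cond_exp M (vimage_algebra (space M) (X s) borel) (\<lambda>\<omega>. indicator A (X t \<omega>)) \<omega>"
      using past[of s "t - s" A] now[of s "t - s" A] st A by (auto elim: AE_mp)
  qed (use X \<open>prob_space M\<close> in auto)
  moreover have "\<forall>t\<ge>0. (\<lambda>x. return borel (f t x)) \<in> borel \<rightarrow>\<^sub>M prob_algebra borel"
    using measurable_compose[OF f measurable_return_prob_space] by auto
  moreover have "\<forall>s\<ge>0. \<forall>t\<ge>0. \<forall>A\<in>sets borel. AE \<omega> in M.
      real_cond_exp M (vimage_algebra (space M) (X s) borel) (\<lambda>\<omega>. indicator A (X (s + t) \<omega>)) \<omega> =
      measure (return borel (f t (X s \<omega>))) A"
    using now by (simp add: measure_return flow)
  ultimately show ?thesis
    unfolding time_homogeneous_markov_process_def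
    by (intro conjI exI[where x = "\<lambda>t x. return borel (f t x)"])
qed

section \<open>The rotation of the circle\<close>

definition rotation_cdf :: "real \<Rightarrow> real \<Rightarrow> real \<Rightarrow> real" where
  "rotation_cdf t = joint_cdf unif01 (\<lambda>u. u) (\<lambda>u. frac (u + t))"

lemma rotation_cdf_half:
  assumes t: "0 \<le> t" "t \<le> 1 / 2"
  shows "rotation_cdf t (1 / 2) (1 / 2) = 1 / 2 - t"
proof -
  let ?S = "{u \<in> space unif01. u \<le> 1 / 2 \<and> frac (u + t) \<le> 1 / 2}"
  have [measurable]: "?S \<in> sets borel" by measurable
  have "emeasure unif01 ?S = (\<integral>\<^sup>+u. indicator ?S u * indicator {0<..<1} u \<partial>lborel)"
    unfolding emeasure_unif01[OF \<open>?S \<in> sets borel\<close>] by (rule nn_integral_unif01) auto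
  also have "\<dots> = (\<integral>\<^sup>+u. indicator {0<..1 / 2 - t} u \<partial>lborel)"
  proof (rule nn_integral_cong_AE)
    \<comment> \<open>Points strictly between 0 and 1/2 do not wrap around. The point 1/2 does when
      \<open>t = 1 / 2\<close>, and is discarded as null.\<close>
    show "AE u in lborel. indicator ?S u * indicator {0<..<1} u = (indicator {0<..1 / 2 - t} u :: ennreal)"
      using AE_lborel_singleton[of "1 / 2 :: real"]
    proof eventually_elim
      case (elim u)
      have "frac (u + t) = u + t" if "0 < u" "u < 1 / 2"
        using that t by (simp add: frac_eq)
      then show ?case using elim t by (auto split: split_indicator)
    qed
  qed
  also have "\<dots> = ennreal (1 / 2 - t)" using t by simp
  finally show ?thesis using t by (simp add: rotation_cdf_def joint_cdf_def measure_def)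
qed

text \<open>Only the left branch of the kink has to be known. Since \<open>g\<close> is nonnegative
  on \<open>t \<ge> 0\<close> and vanishes at 1/2, that point is a local minimum and the derivative
  is 0, whereas the difference quotients from the left are -1.\<close>

lemma rotation_cdf_not_exponential_form: "\<not> exponential_form rotation_cdf"
proof
  assume "exponential_form rotation_cdf"
  then obtain g where g: "\<And>t. g differentiable (at t)"
    and g_eq: "\<And>t. t \<ge> 0 \<Longrightarrow> g t = rotation_cdf t (1 / 2) (1 / 2)"
    using exponential_form_differentiable[of _ "1 / 2" "1 / 2"] by blast
  from g[of "1 / 2"] obtain D where D: "(g has_real_derivative D) (at (1 / 2))"
    by (auto simp: real_differentiable_def)
  have g0: "g (1 / 2) = 0" using g_eq[of "1 / 2"] rotation_cdf_half[of "1 / 2"] by simp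
  have nonneg: "g t \<ge> 0" if "t \<ge> 0" for t
    using g_eq[OF that] by (simp add: rotation_cdf_def joint_cdf_def)
  have "D = 0"
    using D
  proof (rule DERIV_local_min[where d = "1 / 2"])
    show "\<forall>y. \<bar>1 / 2 - y\<bar> < 1 / 2 \<longrightarrow> g (1 / 2) \<le> g y"
    proof (intro allI impI)
      fix y :: real assume "\<bar>1 / 2 - y\<bar> < 1 / 2"
      then have "y \<ge> 0" by linarith
      then show "g (1 / 2) \<le> g y" using nonneg by (simp add: g0)
    qed
  qed simp
  with D have "(\<lambda>h. (g (1 / 2 + h) - g (1 / 2)) / h) \<midarrow>0\<rightarrow> 0"
    by (simp add: DERIV_def)
  from LIM_D[OF this zero_less_one] obtain d where d: "d > 0"
    and *: "\<And>h. h \<noteq> 0 \<Longrightarrow> \<bar>h\<bar> < d \<Longrightarrow> \<bar>g (1 / 2 + h) / h\<bar> < 1" by (auto simp: g0)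
  define h where "h = min (1 / 4) (d / 2)"
  have h: "0 < h" "h \<le> 1 / 4" "h < d" using d by (auto simp: h_def)
  have "g (1 / 2 + - h) = h" using g_eq[of "1 / 2 - h"] rotation_cdf_half[of "1 / 2 - h"] h by simp
  with *[of "- h"] h show False by simp
qed

lemma rotation_process:
  "\<exists>(N :: (real \<Rightarrow> real) measure) V. time_homogeneous_markov_process N V \<and> copula_family N V rotation_cdf"
proof -
  \<comment> \<open>The sample space must consist of functions, so the single uniform variable is
    stored as a constant function, which \<open>V\<close> reads off at 0.\<close>
  define N where "N = distr unif01 (\<Pi>\<^sub>M t\<in>(UNIV :: real set). (borel :: real measure)) (\<lambda>u _. u)"
  define V where "V t \<omega> = frac (\<omega> (0::real) + t)" for t and \<omega> :: "real \<Rightarrow> real"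
  have const: "(\<lambda>u _. u) \<in> unif01 \<rightarrow>\<^sub>M (\<Pi>\<^sub>M t\<in>(UNIV :: real set). (borel :: real measure))"
    by (rule measurable_PiM_single') (auto simp: space_PiM)
  have prob: "prob_space N"
    unfolding N_def by (rule prob_space.prob_space_distr[OF prob_space_unif01 const])
  have V': "V t \<in> borel_measurable (\<Pi>\<^sub>M t\<in>(UNIV :: real set). (borel :: real measure))" for t
    unfolding V_def [abs_def] by measurable
  then have V: "V t \<in> borel_measurable N" for t by (simp add: N_def)
  have flow: "V (s + t) \<omega> = frac (V s \<omega> + t)" for s t \<omega>
    by (simp add: V_def add.assoc)
  have distr: "distr N borel (V s) = unif01" for s
    unfolding N_def distr_distr[OF V' const] using distr_unif01_rotation[of s]
    by (simp add: V_def comp_def)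
  have "joint_cdf N (V s) (V (s + t)) = rotation_cdf t" for s t
  proof (intro ext)
    fix x y
    \<comment> \<open>By the flow property the pair is a fixed function of \<open>V s\<close>, whose
      law does not depend on \<open>s\<close>.\<close>
    have "rotation_cdf t x y = measure (distr N borel (V s)) {u. u \<le> x \<and> frac (u + t) \<le> y}"
      by (simp add: rotation_cdf_def joint_cdf_def distr)
    also have "\<dots> = measure N (V s -` {u. u \<le> x \<and> frac (u + t) \<le> y} \<inter> space N)"
      by (rule measure_distr[OF V]) measurable
    also have "\<dots> = joint_cdf N (V s) (V (s + t)) x y"
      unfolding joint_cdf_def flow by (intro arg_cong[where f = "measure N"]) auto
    finally show "joint_cdf N (V s) (V (s + t)) x y = rotation_cdf t x y" by simp
  qed
  then have "copula_family N V rotation_cdf"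
    using V distr by (simp add: copula_family_def uniform_rv_def)
  moreover have "time_homogeneous_markov_process N V"
    using prob V flow by (intro deterministic_flow_markov[where f = "\<lambda>t u. frac (u + t)"]) auto
  ultimately show ?thesis by blast
qed

theorem mainTheorem3:
  shows "(\<forall>(M :: 'a measure) U.
            reflected_brownian_motion 1 M U \<and> uniform_rv M (U 0) \<longrightarrow>
            (\<exists>Ct. copula_family M U Ct \<and> \<not> exponential_form Ct)) \<and>
         (\<exists>(N :: (real \<Rightarrow> real) measure) V Dt.
            time_homogeneous_markov_process N V \<and> copula_family N V Dt \<and>
            \<not> exponential_form Dt)"
proof (intro conjI allI impI)
  fix M :: "'a measure" and U
  assume "reflected_brownian_motion 1 M U \<and> uniform_rv M (U 0)"
  then have rbm: "reflected_brownian_motion 1 M U" and unif: "uniform_rv M (U 0)" by auto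
  have "copula_family M U (\<lambda>t. joint_cdf M (U 0) (U t))"
    using reflected_brownian_motion_uniform[OF rbm unif]
      reflected_brownian_motion_stationary[OF rbm unif]
    by (simp add: copula_family_def)
  then show "\<exists>Ct. copula_family M U Ct \<and> \<not> exponential_form Ct"
    using reflected_brownian_motion_not_exponential_form[OF rbm unif] by blast
next
  show "\<exists>(N :: (real \<Rightarrow> real) measure) V Dt.
      time_homogeneous_markov_process N V \<and> copula_family N V Dt \<and> \<not> exponential_form Dt"
    using rotation_process rotation_cdf_not_exponential_form by blast
qed

end
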